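(* Let $p$ be a prime, let $a\in\mathbb{C}_p$ with $a\neq 0$, let $f(x)=\frac{a}{x^2}$ for $x\in\mathbb{C}_p\setminus\{0\}$, and let $\alpha=(|a|_p)^{1/3}$. Then: 1. if $x\in U_\alpha(0)$, $x\neq 0$, then $$\lim_{k\to\infty}f^{2k}(x)=0,\qquad \lim_{k\to\infty}|f^{2k-1}(x)|_p=+\infty;$$ 2. if $x\in S_\alpha(0)$, then $f^n(x)\in S_\alpha(0)$ for all $n\geq 1$; 3. if $x\in\mathbb{C}_p\setminus V_\alpha(0)$, then $$\lim_{k\to\infty}|f^{2k}(x)|_p=+\infty,\qquad \lim_{k\to\infty}f^{2k-1}(x)=0.$$
   Context: $\mathbb{C}_p$ is the field of complex $p$-adic numbers (the completion of the algebraic closure of $\mathbb{Q}_p$) with the $p$-adic norm $|\cdot|_p$ normalized by $|p|_p=1/p$. For $c\in\mathbb{C}_p$ and $r>0$: $U_r(c)=\{x\in\mathbb{C}_p:|x-c|_p<r\}$, $V_r(c)=\{x\in\mathbb{C}_p:|x-c|_p\leq r\}$, $S_r(c)=\{x\in\mathbb{C}_p:|x-c|_p=r\}$. $f^n$ denotes the $n$-fold composition of $f$ with itself; $f$ maps $\mathbb{C}_p\setminus\{0\}$ to itself. *)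

theory Defs
  imports "HOL-Analysis.Analysis" "HOL-Algebra.Algebraic_Closure_Type"
begin

text \<open>Fields of characteristic 0 with a non-archimedean absolute value, carrying the induced
  metric, so that limits, balls, spheres and completeness are those of the library. The absolute
  value is a class parameter of its own because the library's \<open>norm\<close> is constrained to
  vector spaces over the reals.\<close>

class nonarch_valued_field = field_char_0 + metric_space +
  fixes vnorm :: "'a \<Rightarrow> real"
  assumes vnorm_nonneg: "vnorm x \<ge> 0"
    and vnorm_eq_zero: "vnorm x = 0 \<longleftrightarrow> x = 0"
    and vnorm_mult: "vnorm (x * y) = vnorm x * vnorm y"
    and vnorm_add: "vnorm (x + y) \<le> max (vnorm x) (vnorm y)"
    and dist_vnorm: "dist x y = vnorm (x - y)"

definition padic_norm :: "nat \<Rightarrow> rat \<Rightarrow> real" where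
  "padic_norm p q = (if q = 0 then 0 else
     (case quotient_of q of (m, n) \<Rightarrow>
        real p powi (int (multiplicity (int p) n) - int (multiplicity (int p) m))))"

lemma padic_norm_self: "Factorial_Ring.prime p \<Longrightarrow> padic_norm p (of_nat p) = 1 / real p"
proof -
  assume p: "Factorial_Ring.prime p"
  have "quotient_of (of_nat p) = (int p, 1)"
    using quotient_of_int[of "int p"] by (simp add: of_int_def[symmetric])
  moreover have "multiplicity (int p) (int p) = 1"
    using p by (intro multiplicity_self) (auto simp: prime_gt_0_nat prime_gt_Suc_0_nat dest: prime_gt_1_nat)
  ultimately show ?thesis
    using p by (auto simp: padic_norm_def power_int_minus field_simps)
qed

text \<open>The type \<open>'a\<close> is (isometrically isomorphic to) the field of complex \<open>p\<close>-adic numbers, i.e. the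
  completion of an algebraic closure of the \<open>p\<close>-adic numbers. The construction is
  read off inside \<open>'a\<close>: the absolute value of \<open>'a\<close> extends the \<open>p\<close>-adic norm of the
  rationals; as \<open>'a\<close> is complete, the topological closure of \<open>\<rat>\<close> is the completion of \<open>\<rat>\<close>,
  that is, the field of \<open>p\<close>-adic numbers; and \<open>L\<close> is an algebraic closure of it that is dense in
  the complete space \<open>'a\<close>.\<close>

definition complex_padic :: "nat \<Rightarrow> 'a :: nonarch_valued_field itself \<Rightarrow> bool" where
  "complex_padic p _ \<longleftrightarrow>
     Factorial_Ring.prime p \<and>
     (\<forall>q. vnorm (of_rat q :: 'a) = padic_norm p q) \<and>
     complete (UNIV :: 'a set) \<and>
     (\<exists>L :: 'a set.
        algebraic_closure (ring_of_type_algebra\<lparr>carrier := L\<rparr>) (closure \<rat>) \<and>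
        closure L = UNIV)"

end

theory Submission
  imports Defs
begin

text \<open>
  The sphere of radius \<open>\<alpha> = \<bar>a\<bar>\<^sup>1\<^sup>/\<^sup>3\<close> is the one radius that \<open>f\<close> preserves: since
  \<open>\<bar>f x\<bar> = \<bar>a\<bar> / \<bar>x\<bar>\<^sup>2\<close> and \<open>\<bar>a\<bar> = \<alpha>\<^sup>3\<close>, the normalized radius \<open>t = \<bar>x\<bar> / \<alpha>\<close> evolves by
  \<open>t \<mapsto> t\<^sup>-\<^sup>2\<close>, whatever the direction of \<open>x\<close>. So the radius after \<open>n\<close> steps is \<open>\<alpha>\<close> times
  \<open>t\<close> raised to the power \<open>(-2)\<^sup>n\<close> (\<open>vnorm_funpow_inverse_square\<close>). The sign of the exponent is
  the parity of \<open>n\<close>, and its modulus grows without bound. Hence for \<open>t < 1\<close> the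
  even iterates shrink to \<open>0\<close> and the odd ones escape, for \<open>t > 1\<close> the roles are exchanged, and
  for \<open>t = 1\<close> the radius stays \<open>\<alpha>\<close>.
\<close>

lemma vnorm_one [simp]: "vnorm (1 :: 'a :: nonarch_valued_field) = 1"
  using vnorm_mult[of "1 :: 'a" 1] vnorm_eq_zero[of "1 :: 'a"] by simp

lemma vnorm_power: "vnorm (x ^ n :: 'a :: nonarch_valued_field) = vnorm x ^ n"
  by (induction n) (simp_all add: vnorm_mult)

lemma vnorm_divide: "vnorm (x / y :: 'a :: nonarch_valued_field) = vnorm x / vnorm y"
proof (cases "y = 0")
  case True
  then show ?thesis
    using vnorm_eq_zero[of "0 :: 'a"] by simp
next
  case False
  then show ?thesis
    using vnorm_mult[of "x / y" y] vnorm_eq_zero[of y] by (simp add: field_simps)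
qed

lemma vnorm_pos: "x \<noteq> 0 \<Longrightarrow> vnorm (x :: 'a :: nonarch_valued_field) > 0"
  using vnorm_nonneg[of x] vnorm_eq_zero[of x] by simp

lemma dist_zero_vnorm: "dist 0 (x :: 'a :: nonarch_valued_field) = vnorm x"
  using dist_vnorm[of x 0] by (simp add: dist_commute)

lemma tendsto_zero_vnorm_iff:
  fixes g :: "'b \<Rightarrow> 'a :: nonarch_valued_field"
  shows "(g \<longlongrightarrow> 0) F \<longleftrightarrow> ((\<lambda>x. vnorm (g x)) \<longlongrightarrow> 0) F"
  unfolding tendsto_dist_iff[of g 0 F] by (simp add: dist_vnorm)

text \<open>The power of \<open>t = \<bar>x\<bar> / r\<close> with exponent \<open>(-2)\<^sup>n\<close>, split by parity so that only natural
  exponents occur. Non-vanishing of the orbit is part of the induction because \<open>f\<close> is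
  unconstrained at \<open>0\<close>.\<close>
lemma vnorm_funpow_inverse_square:
  fixes a x :: "'a :: nonarch_valued_field"
  assumes f: "\<And>x. x \<noteq> 0 \<Longrightarrow> f x = a / x ^ 2"
    and r: "r > 0" "r ^ 3 = vnorm a"
    and x: "x \<noteq> 0"
  shows "(f ^^ n) x \<noteq> 0 \<and>
    vnorm ((f ^^ n) x) = r * (if even n then vnorm x / r else r / vnorm x) ^ (2 ^ n)"
proof (induction n)
  case 0
  then show ?case using r x by simp
next
  case (Suc n)
  define s where "s = (if even n then vnorm x / r else r / vnorm x)"
  define q where "q = s ^ (2 ^ n)"
  have "q > 0"
    using r vnorm_pos[OF x] by (simp add: q_def s_def)
  have nz: "(f ^^ n) x \<noteq> 0" and IH: "vnorm ((f ^^ n) x) = r * q"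
    using Suc.IH by (simp_all add: s_def q_def)
  have "a \<noteq> 0"
    using r vnorm_eq_zero[of a] by auto
  have "vnorm ((f ^^ Suc n) x) = r ^ 3 / (r * q) ^ 2"
    using nz IH r by (simp add: f vnorm_divide vnorm_power)
  also have "\<dots> = r * (1 / q) ^ 2"
    using r \<open>q > 0\<close> by (simp add: field_simps power2_eq_square power3_eq_cube)
  also have "(1 / q) ^ 2 = (1 / s) ^ (2 ^ Suc n)"
    by (simp only: q_def power_divide power_one power_Suc2 power_mult)
  also have "1 / s = (if even (Suc n) then vnorm x / r else r / vnorm x)"
    by (simp add: s_def)
  finally show ?case
    using nz \<open>a \<noteq> 0\<close> by (simp add: f)
qed

lemma filterlim_power_two_power:
  assumes "filterlim g at_top F"
  shows "filterlim (\<lambda>k. 2 ^ g k :: nat) at_top F"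
proof (rule filterlim_at_top_mono[OF assms])
  show "\<forall>\<^sub>F k in F. g k \<le> 2 ^ g k"
    by (intro always_eventually allI less_imp_le less_exp)
qed

lemma tendsto_zero_mult_double_power:
  fixes r s :: real
  assumes "filterlim g at_top F" "0 \<le> s" "s < 1"
  shows "((\<lambda>k. r * s ^ (2 ^ g k)) \<longlongrightarrow> 0) F"
  using assms
  by (intro tendsto_mult_right_zero filterlim_compose[OF LIMSEQ_power_zero]
      filterlim_power_two_power) auto

lemma filterlim_mult_double_power_at_top:
  fixes r s :: real
  assumes "filterlim g at_top F" "r > 0" "s > 1"
  shows "filterlim (\<lambda>k. r * s ^ (2 ^ g k)) at_top F"
proof -
  have "filterlim (\<lambda>n. s ^ n) at_top sequentially"
    using assms(3)
    by (intro filterlim_at_infinity_imp_filterlim_at_top filterlim_realpow_sequentially_gt1) auto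
  from filterlim_compose[OF this filterlim_power_two_power[OF assms(1)]]
  show ?thesis
    by (rule filterlim_tendsto_pos_mult_at_top[OF tendsto_const assms(2)])
qed

theorem theorem1:
  fixes p :: nat and a :: "'a :: nonarch_valued_field" and f :: "'a \<Rightarrow> 'a" and \<alpha> :: real
  assumes "Factorial_Ring.prime p"
    and "complex_padic p TYPE('a)"
    and "a \<noteq> 0"
    and "\<And>x. x \<noteq> 0 \<Longrightarrow> f x = a / x ^ 2"
    and "\<alpha> = vnorm a powr (1 / 3)"
  shows "(\<forall>x \<in> ball 0 \<alpha>. x \<noteq> 0 \<longrightarrow>
            (\<lambda>k. (f ^^ (2 * k)) x) \<longlonglongrightarrow> 0 \<and>
            filterlim (\<lambda>k. vnorm ((f ^^ (2 * k - 1)) x)) at_top sequentially) \<and>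
         (\<forall>x \<in> sphere 0 \<alpha>. \<forall>n \<ge> 1. (f ^^ n) x \<in> sphere 0 \<alpha>) \<and>
         (\<forall>x \<in> UNIV - cball 0 \<alpha>.
            filterlim (\<lambda>k. vnorm ((f ^^ (2 * k)) x)) at_top sequentially \<and>
            (\<lambda>k. (f ^^ (2 * k - 1)) x) \<longlonglongrightarrow> 0)"
proof -
  have a_pos: "vnorm a > 0"
    using assms(3) by (rule vnorm_pos)
  have \<alpha>_pos: "\<alpha> > 0"
    using a_pos assms(5) by simp
  have "\<alpha> ^ 3 = \<alpha> powr 3"
    using \<alpha>_pos by simp
  also have "\<dots> = vnorm a"
    using a_pos by (simp add: assms(5) powr_powr)
  finally have \<alpha>_cube: "\<alpha> ^ 3 = vnorm a" .
  have orbit: "vnorm ((f ^^ n) x) =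
      \<alpha> * (if even n then vnorm x / \<alpha> else \<alpha> / vnorm x) ^ (2 ^ n)" if "x \<noteq> 0" for x n
    using vnorm_funpow_inverse_square[of f a \<alpha> x n, OF _ \<alpha>_pos \<alpha>_cube that] assms(4)
    by simp

  have even_lim: "filterlim (\<lambda>k::nat. 2 * k) at_top sequentially"
    by (intro filterlim_at_top_mono[OF filterlim_ident] always_eventually) simp
  have odd_lim: "filterlim (\<lambda>k::nat. 2 * k - 1) at_top sequentially"
    by (intro filterlim_at_top_mono[OF filterlim_ident]
        eventually_mono[OF eventually_gt_at_top[of 0]]) simp
  have even_norm: "vnorm ((f ^^ (2 * k)) x) = \<alpha> * (vnorm x / \<alpha>) ^ (2 ^ (2 * k))"
    if "x \<noteq> 0" for x k
    using orbit[OF that, of "2 * k"] by simp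
  \<comment> \<open>\<open>k = 0\<close> is excluded: there \<open>2 * k - 1\<close> truncates to the even number \<open>0\<close>.\<close>
  have odd_norm: "\<forall>\<^sub>F k in sequentially.
      \<alpha> * (\<alpha> / vnorm x) ^ (2 ^ (2 * k - 1)) = vnorm ((f ^^ (2 * k - 1)) x)"
    if "x \<noteq> 0" for x
    using eventually_gt_at_top[of 0]
  proof eventually_elim
    case (elim k)
    then show ?case using orbit[OF that, of "2 * k - 1"] by simp
  qed

  have inside: "(\<lambda>k. (f ^^ (2 * k)) x) \<longlonglongrightarrow> 0 \<and>
      filterlim (\<lambda>k. vnorm ((f ^^ (2 * k - 1)) x)) at_top sequentially"
    if "x \<in> ball 0 \<alpha>" "x \<noteq> 0" for x
  proof
    have x: "0 < vnorm x" "vnorm x < \<alpha>"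
      using that by (simp_all add: dist_zero_vnorm vnorm_pos)
    show "(\<lambda>k. (f ^^ (2 * k)) x) \<longlonglongrightarrow> 0"
      unfolding tendsto_zero_vnorm_iff even_norm[OF that(2)]
      using x by (intro tendsto_zero_mult_double_power even_lim) simp_all
    have "filterlim (\<lambda>k. \<alpha> * (\<alpha> / vnorm x) ^ (2 ^ (2 * k - 1))) at_top sequentially"
      using x by (intro filterlim_mult_double_power_at_top odd_lim) simp_all
    then show "filterlim (\<lambda>k. vnorm ((f ^^ (2 * k - 1)) x)) at_top sequentially"
      using filterlim_cong[OF refl refl odd_norm[OF that(2)]] by simp
  qed

  have on_sphere: "(f ^^ n) x \<in> sphere 0 \<alpha>" if "x \<in> sphere 0 \<alpha>" for x n
  proof -
    have x: "vnorm x = \<alpha>"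
      using that by (simp add: dist_zero_vnorm)
    then have "x \<noteq> 0"
      using \<alpha>_pos vnorm_eq_zero[of x] by auto
    then show ?thesis
      using orbit[of x n] x \<alpha>_pos by (simp add: dist_zero_vnorm)
  qed

  have outside: "filterlim (\<lambda>k. vnorm ((f ^^ (2 * k)) x)) at_top sequentially \<and>
      (\<lambda>k. (f ^^ (2 * k - 1)) x) \<longlonglongrightarrow> 0"
    if "x \<in> UNIV - cball 0 \<alpha>" for x
  proof
    have x: "vnorm x > \<alpha>"
      using that by (simp add: dist_zero_vnorm)
    then have nz: "x \<noteq> 0"
      using \<alpha>_pos vnorm_eq_zero[of x] by auto
    show "filterlim (\<lambda>k. vnorm ((f ^^ (2 * k)) x)) at_top sequentially"
      unfolding even_norm[OF nz]
      using x \<alpha>_pos by (intro filterlim_mult_double_power_at_top even_lim) simp_all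
    have "(\<lambda>k. \<alpha> * (\<alpha> / vnorm x) ^ (2 ^ (2 * k - 1))) \<longlonglongrightarrow> 0"
      using x \<alpha>_pos by (intro tendsto_zero_mult_double_power odd_lim) simp_all
    then show "(\<lambda>k. (f ^^ (2 * k - 1)) x) \<longlonglongrightarrow> 0"
      unfolding tendsto_zero_vnorm_iff
      using tendsto_cong[OF odd_norm[OF nz]] by simp
  qed

  show ?thesis
    by (intro conjI ballI allI impI inside[THEN conjunct1] inside[THEN conjunct2] on_sphere
        outside[THEN conjunct1] outside[THEN conjunct2])
qed

end
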